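(* Let $R$ be a commutative Artinian ring with identity such that the graph $\Gamma_{reg}(R)$ is connected. Then the radius of $\Gamma_{reg}(R)$ equals $3$, i.e. $\min_I e(I)=3$, where $I$ runs over the vertices of $\Gamma_{reg}(R)$ and $e(I)$ is the eccentricity of $I$.
   Context: For an $R$-module $M$, $Z(M)$ is the set of zero-divisors of $M$, i.e. the set of $r\in R$ with $rm=0$ for some nonzero $m\in M$; an element $r\in R$ is $M$-regular if $r\notin Z(M)$. A non-trivial ideal of $R$ is an ideal different from $(0)$ and $R$. The regular graph of ideals $\Gamma_{reg}(R)$ is the simple graph whose vertices are the non-trivial ideals of $R$, two distinct vertices $I,J$ being adjacent if and only if $I$ contains a $J$-regular element or $J$ contains an $I$-regular element. A graph is connected if there is a path between any two distinct vertices. The eccentricity $e(I)$ of a vertex $I$ of a connected graph is the maximum of the distances from $I$ to the other vertices; the radius is the minimum eccentricity.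
   Formalization: The graph is additionally assumed to have at least two vertices: with one vertex (e.g. R = Z/4) it is trivially connected but the eccentricity is a maximum over the empty set and the radius is not 3, and with no vertices (R a field) the minimum is undefined. *)

theory Defs
  imports "Graph_Theory.Graph_Theory" "HOL-Algebra.Module" "HOL-Algebra.Ideal"
begin

locale artinian_cring = cring +
  assumes descending_chain_condition:
    "\<And>C :: nat \<Rightarrow> 'a set. (\<And>n. ideal (C n) R) \<Longrightarrow> (\<And>n. C (Suc n) \<subseteq> C n) \<Longrightarrow>
      \<exists>N. \<forall>n\<ge>N. C n = C N"

definition module_zero_divisors ::
    "('a, 'm) ring_scheme \<Rightarrow> ('a, 'b, 'n) module_scheme \<Rightarrow> 'a set" where
  "module_zero_divisors R M =
    {r \<in> carrier R. \<exists>m \<in> carrier M. m \<noteq> \<zero>\<^bsub>M\<^esub> \<and> r \<odot>\<^bsub>M\<^esub> m = \<zero>\<^bsub>M\<^esub>}"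

definition module_regular ::
    "('a, 'm) ring_scheme \<Rightarrow> ('a, 'b, 'n) module_scheme \<Rightarrow> 'a \<Rightarrow> bool" where
  "module_regular R M r \<longleftrightarrow> r \<in> carrier R \<and> r \<notin> module_zero_divisors R M"

text \<open>
  The record type of modules also has ring multiplication and unit fields. They play no role for
  modules and are simply inherited from the ring here.
\<close>

definition ideal_module :: "('a, 'm) ring_scheme \<Rightarrow> 'a set \<Rightarrow> ('a, 'a) module" where
  "ideal_module R I =
    \<lparr>carrier = I, mult = (\<otimes>\<^bsub>R\<^esub>), one = \<one>\<^bsub>R\<^esub>, zero = \<zero>\<^bsub>R\<^esub>,
     add = (\<oplus>\<^bsub>R\<^esub>), smult = (\<otimes>\<^bsub>R\<^esub>)\<rparr>"

lemma (in cring) module_ideal_module: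
  assumes "ideal I R"
  shows "module R (ideal_module R I)"
proof -
  interpret I: ideal I R by fact
  have sub: "x \<in> carrier R" if "x \<in> I" for x
    using that by (rule I.a_Hcarr)
  show ?thesis
  proof (rule moduleI)
    show "cring R" ..
    show "abelian_group (ideal_module R I)"
    proof (rule abelian_groupI)
      fix x assume "x \<in> carrier (ideal_module R I)"
      then show "\<exists>y\<in>carrier (ideal_module R I).
          y \<oplus>\<^bsub>ideal_module R I\<^esub> x = \<zero>\<^bsub>ideal_module R I\<^esub>"
        by (auto simp: ideal_module_def sub intro!: bexI [of _ "\<ominus> x"] l_neg)
    qed (auto simp: ideal_module_def sub a_ac)
  qed (auto simp: ideal_module_def sub I.I_l_closed l_distr r_distr m_assoc)
qed

definition nontrivial_ideals :: "('a, 'm) ring_scheme \<Rightarrow> 'a set set" where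
  "nontrivial_ideals R = {I. ideal I R \<and> I \<noteq> {\<zero>\<^bsub>R\<^esub>} \<and> I \<noteq> carrier R}"

definition contains_regular :: "('a, 'm) ring_scheme \<Rightarrow> 'a set \<Rightarrow> 'a set \<Rightarrow> bool" where
  "contains_regular R I J \<longleftrightarrow> (\<exists>r\<in>I. module_regular R (ideal_module R J) r)"

text \<open>
  An undirected simple graph is represented by a symmetric loop-free set of arcs. The vertex set may
  be infinite, so the finiteness assumption of the locale \<^locale>\<open>pair_graph\<close> is not available.
\<close>

definition regular_graph_of_ideals :: "('a, 'm) ring_scheme \<Rightarrow> 'a set pair_pre_digraph" where
  "regular_graph_of_ideals R =
    \<lparr>pverts = nontrivial_ideals R,
     parcs = {(I, J). I \<in> nontrivial_ideals R \<and> J \<in> nontrivial_ideals R \<and> I \<noteq> J \<and>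
       (contains_regular R I J \<or> contains_regular R J I)}\<rparr>"

lemma pair_bidirected_digraph_regular_graph_of_ideals:
  "pair_bidirected_digraph (regular_graph_of_ideals R)"
  by unfold_locales (auto simp: regular_graph_of_ideals_def symmetric_def arcs_ends_def
    arc_to_ends_def intro!: symI)

text \<open>
  Distance is the least cost of a walk where every arc has cost 1. It is a natural number or
  \<open>\<infinity>\<close>. Hence a finite supremum below (over a nonempty set) is a maximum, and the infimum over a
  nonempty vertex set is a minimum. For a one-vertex graph there are no other vertices, and the
  eccentricity takes the meaningless value \<open>-\<infinity>\<close>.
\<close>

definition graph_distance :: "('v, 'e) pre_digraph \<Rightarrow> 'v \<Rightarrow> 'v \<Rightarrow> ereal" where
  "graph_distance G u v = wf_digraph.\<mu> G (\<lambda>_. 1) u v"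

definition eccentricity :: "('v, 'e) pre_digraph \<Rightarrow> 'v \<Rightarrow> ereal" where
  "eccentricity G u = (SUP v \<in> verts G - {u}. graph_distance G u v)"

definition radius :: "('v, 'e) pre_digraph \<Rightarrow> ereal" where
  "radius G = (INF u \<in> verts G. eccentricity G u)"

end

theory Submission
  imports Defs
begin

text \<open>
  By Fitting's lemma, \<open>I\<close> contains a \<open>J\<close>-regular element iff there is an idempotent \<open>e\<close> with
  \<open>J \<subseteq> eR \<subseteq> I\<close>, so adjacency only depends on the lattice of idempotents.

  Every vertex \<open>I\<close> has a vertex at distance at least 3. If some idempotent \<open>f \<noteq> 1\<close> satisfies
  \<open>I \<subseteq> fR\<close>, take \<open>(1 - f)R\<close> for a minimal such \<open>f\<close>; otherwise take \<open>(1 - e)R\<close> for the largest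
  idempotent \<open>e\<close> of \<open>I\<close>, which is nonzero because \<open>I\<close> is not isolated.

  Connectedness provides a field factor \<open>eR\<close>: if all minimal ideals had square zero, the socle would
  be an isolated vertex. It also provides a nontrivial idempotent \<open>g\<close> of \<open>(1 - e)R\<close>, since otherwise
  the vertices containing \<open>e\<close> would be closed under adjacency. Then \<open>(e + g)R\<close> has eccentricity at
  most 3: if \<open>e \<in> J\<close>, go through \<open>eR\<close> to \<open>J\<close>; otherwise \<open>J \<subseteq> (1 - e)R\<close>, and \<open>gR\<close>,
  \<open>(1 - e)R\<close>, \<open>J\<close> is a path.
\<close>

no_notation vwalk_join (infixr "\<oplus>" 65)

section \<open>Distances and connectedness\<close>

text \<open>Powers of the reflexive closure express "at most \<open>n\<close> arcs" as exactly
  \<open>n\<close> steps, so a path can be given without checking that consecutive vertices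
  differ.\<close>

lemma (in pair_wf_digraph) graph_distance_le:
  assumes "u \<in> pverts G" and "(u, v) \<in> ((parcs G)\<^sup>=) ^^ n"
  shows "graph_distance (with_proj G) u v \<le> ereal (real n)"
proof -
  have "\<exists>p. awalk u p v \<and> length p \<le> n"
    using assms
  proof (induction n arbitrary: u)
    case 0
    then show ?case
      by (auto simp: awalk_Nil_iff)
  next
    case (Suc n)
    from Suc.prems(2) obtain w where w: "(u, w) \<in> (parcs G)\<^sup>=" "(w, v) \<in> ((parcs G)\<^sup>=) ^^ n"
      by (metis relpow_Suc_E2)
    have "w \<in> pverts G"
      using w(1) Suc.prems(1) in_arcsD2 by auto
    then obtain p where p: "awalk w p v" "length p \<le> n"
      using Suc.IH w(2) by blast
    show ?case
    proof (cases "u = w")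
      case True
      then show ?thesis using p by (metis le_SucI)
    next
      case False
      then have "awalk u ((u, w) # p) v"
        using p(1) w(1) Suc.prems(1) by (auto simp: awalk_Cons_iff)
      then show ?thesis using p(2) by (metis Suc_le_mono length_Cons)
    qed
  qed
  then obtain p where p: "awalk u p v" "length p \<le> n" by blast
  have "awalk_cost (\<lambda>_. 1) p = real (length p)"
    by (induction p) auto
  then show ?thesis
    using min_cost_le_walk_cost[OF p(1), of "\<lambda>_. 1"] p(2)
    by (simp add: graph_distance_def order_trans[of _ "ereal (real (length p))"])
qed

text \<open>A walk \<open>p\<close> puts its ends into \<open>parcs G ^^ length p\<close>, so every
  walk has at least \<open>n\<close> arcs. If there is no walk at all, the infimum is \<infinity>
  and the bound still holds.\<close>

lemma (in pair_wf_digraph) graph_distance_ge: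
  assumes "\<And>k. k < n \<Longrightarrow> (u, v) \<notin> parcs G ^^ k"
  shows "ereal (real n) \<le> graph_distance (with_proj G) u v"
  unfolding graph_distance_def \<mu>_def
proof (rule INF_greatest)
  fix p assume "p \<in> {p. awalk u p v}"
  then have "(u, v) \<in> parcs G ^^ length p"
  proof (induction p arbitrary: u)
    case Nil
    then show ?case by (simp add: awalk_Nil_iff)
  next
    case (Cons a p)
    then show ?case
      by (cases a) (auto simp: awalk_Cons_iff simp del: relpow.simps intro: relpow_Suc_I2)
  qed
  then have "n \<le> length p"
    using assms not_le by blast
  moreover have "awalk_cost (\<lambda>_. 1) p = real (length p)"
    by (induction p) auto
  ultimately show "ereal (real n) \<le> ereal (awalk_cost (\<lambda>_. 1) p)"
    by simp
qed

text \<open>Connectedness is reachability in the symmetric closure, so membership in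
  \<open>A\<close> passes along arcs taken in either direction. The lemma serves to refute closed
  sets that miss a vertex.\<close>

lemma connected_closed_set:
  assumes "Digraph_Component.connected (with_proj G)"
    and closed: "\<And>u v. u \<in> A \<Longrightarrow> (u, v) \<in> parcs G \<or> (v, u) \<in> parcs G \<Longrightarrow> v \<in> A"
    and "x \<in> A" "x \<in> pverts G" "y \<in> pverts G"
  shows "y \<in> A"
proof -
  have "x \<rightarrow>\<^sup>*\<^bsub>with_proj (mk_symmetric (with_proj G))\<^esub> y"
    using assms by (auto simp: connected_def strongly_connected_def mk_symmetric_def)
  then have "(x, y) \<in> rtrancl_on (pverts G) (parcs (mk_symmetric (with_proj G)))"
    by (simp add: reachable_def mk_symmetric_def)
  then show ?thesis
    using \<open>x \<in> A\<close>
  proof induction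
    case (step a b)
    then show ?case
      using closed[of a b] by (auto simp: mk_symmetric_def)
  qed
qed

section \<open>Idempotents and minimal ideals\<close>

context cring
begin

definition idempotent :: "'a \<Rightarrow> bool" where
  "idempotent e \<longleftrightarrow> e \<in> carrier R \<and> e \<otimes> e = e"

lemma idempotent_closed: "idempotent e \<Longrightarrow> e \<in> carrier R"
  by (simp add: idempotent_def)

lemma idempotent_zero: "idempotent \<zero>" and idempotent_one: "idempotent \<one>"
  by (simp_all add: idempotent_def)

lemma idempotent_compl:
  assumes "idempotent e"
  shows "idempotent (\<one> \<ominus> e)"
proof -
  have e: "e \<in> carrier R" "e \<otimes> e = e" using assms by (auto simp: idempotent_def)
  have "(\<one> \<ominus> e) \<otimes> (\<one> \<ominus> e) = \<one> \<ominus> e \<ominus> e \<oplus> e \<otimes> e" using e(1) by algebra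
  also have "\<dots> = \<one> \<ominus> e" unfolding e(2) using e(1) by algebra
  finally show ?thesis using e by (simp add: idempotent_def)
qed

lemma idempotent_mult:
  assumes "idempotent e" and "idempotent f"
  shows "idempotent (e \<otimes> f)"
proof -
  have ef: "e \<in> carrier R" "e \<otimes> e = e" "f \<in> carrier R" "f \<otimes> f = f"
    using assms by (auto simp: idempotent_def)
  have "(e \<otimes> f) \<otimes> (e \<otimes> f) = (e \<otimes> e) \<otimes> (f \<otimes> f)"
    using ef(1,3) by algebra
  then show ?thesis using ef by (simp add: idempotent_def)
qed

lemma compl_compl: "e \<in> carrier R \<Longrightarrow> \<one> \<ominus> (\<one> \<ominus> e) = e"
  by algebra

lemma compl_mult: "e \<in> carrier R \<Longrightarrow> x \<in> carrier R \<Longrightarrow> (\<one> \<ominus> e) \<otimes> x = x \<ominus> e \<otimes> x"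
  by algebra

text \<open>Multiplication by \<open>e\<close> projects onto \<open>PIdl e\<close>, and the members
  are its fixed points. Inclusions in idempotent ideals thereby become equations.\<close>

lemma mem_idempotent_ideal:
  assumes "idempotent e"
  shows "x \<in> PIdl e \<longleftrightarrow> x \<in> carrier R \<and> e \<otimes> x = x"
proof
  assume "x \<in> PIdl e"
  then obtain y where "y \<in> carrier R" "x = y \<otimes> e" by (auto simp: cgenideal_def)
  then show "x \<in> carrier R \<and> e \<otimes> x = x"
    using assms m_lcomm[of e y e] by (simp add: idempotent_def)
next
  assume "x \<in> carrier R \<and> e \<otimes> x = x"
  then show "x \<in> PIdl e"
    using assms m_comm[of e x] unfolding cgenideal_def idempotent_def by auto
qed

text \<open>The ideal of the complement is the kernel of the same projection, because
  \<open>x \<ominus> e \<otimes> x\<close> equals \<open>x\<close> exactly when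
  \<open>e \<otimes> x\<close> vanishes.\<close>

lemma mem_compl_ideal:
  assumes "idempotent e"
  shows "x \<in> PIdl (\<one> \<ominus> e) \<longleftrightarrow> x \<in> carrier R \<and> e \<otimes> x = \<zero>"
proof -
  have e: "e \<in> carrier R" by (rule idempotent_closed[OF assms])
  have "x \<ominus> e \<otimes> x = x \<longleftrightarrow> e \<otimes> x = \<zero>" if x: "x \<in> carrier R"
  proof
    assume *: "x \<ominus> e \<otimes> x = x"
    have "e \<otimes> x = x \<ominus> (x \<ominus> e \<otimes> x)" using e x by algebra
    also have "\<dots> = \<zero>" unfolding * using x by (simp add: a_minus_def r_neg)
    finally show "e \<otimes> x = \<zero>" .
  qed (use x in \<open>simp add: a_minus_def\<close>)
  then show ?thesis
    using mem_idempotent_ideal[OF idempotent_compl[OF assms]] compl_mult[OF idempotent_closed[OF assms]]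
    by auto
qed

lemma cgenideal_mult:
  assumes "a \<in> carrier R" "x \<in> carrier R"
  shows "x \<otimes> a \<in> PIdl a" "a \<otimes> x \<in> PIdl a"
  using assms m_comm[of a x] unfolding cgenideal_def by blast+

lemma cgenideal_zero: "PIdl \<zero> = {\<zero>}"
  by (auto simp: cgenideal_def intro: exI[of _ \<zero>])

text \<open>The two elements add up to \<open>\<one>\<close>. Contradictions below arise when a
  vertex would contain both.\<close>

lemma idempotent_and_compl_mem:
  assumes "ideal I R" "e \<in> I" "\<one> \<ominus> e \<in> I"
  shows "I = carrier R"
proof -
  have e: "e \<in> carrier R" using assms ideal.Icarr by fast
  have "e \<oplus> (\<one> \<ominus> e) \<in> I"
    using assms by (meson additive_subgroup.a_closed ideal.axioms(1))
  moreover have "e \<oplus> (\<one> \<ominus> e) = \<one>" using e by algebra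
  ultimately show ?thesis using ideal.one_imp_carrier[OF assms(1)] by simp
qed


lemma idempotent_ideal: "idempotent e \<Longrightarrow> ideal (PIdl e) R"
  by (simp add: cgenideal_ideal idempotent_closed)

lemma idempotent_mem_ideal: "idempotent e \<Longrightarrow> e \<in> PIdl e"
  by (simp add: cgenideal_self idempotent_closed)

lemma idempotent_ideal_disjoint:
  "idempotent e \<Longrightarrow> x \<in> PIdl e \<Longrightarrow> x \<in> PIdl (\<one> \<ominus> e) \<Longrightarrow> x = \<zero>"
  by (simp add: mem_idempotent_ideal mem_compl_ideal)

lemma compl_eq_zero_iff: "e \<in> carrier R \<Longrightarrow> \<one> \<ominus> e = \<zero> \<longleftrightarrow> e = \<one>"
  by (metis compl_compl a_minus_def minus_zero one_closed r_zero r_neg)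

lemma compl_eq_one_iff: "e \<in> carrier R \<Longrightarrow> \<one> \<ominus> e = \<one> \<longleftrightarrow> e = \<zero>"
  by (metis compl_compl a_minus_def minus_zero one_closed r_zero r_neg)

lemma idempotent_ideal_nontrivial:
  assumes "idempotent e" "e \<noteq> \<zero>" "e \<noteq> \<one>"
  shows "PIdl e \<in> nontrivial_ideals R"
proof -
  have "\<one> \<notin> PIdl e"
    using assms by (auto simp: mem_idempotent_ideal idempotent_closed)
  then show ?thesis
    using assms idempotent_ideal idempotent_mem_ideal by (auto simp: nontrivial_ideals_def)
qed

section \<open>Minimal ideals and the socle\<close>

definition minimal_ideal :: "'a set \<Rightarrow> bool" where
  "minimal_ideal M \<longleftrightarrow> ideal M R \<and> M \<noteq> {\<zero>} \<and>
    (\<forall>J. ideal J R \<longrightarrow> J \<subseteq> M \<longrightarrow> J = {\<zero>} \<or> J = M)"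

lemma minimal_ideal_eq_cgenideal:
  assumes "minimal_ideal M" "x \<in> M" "x \<noteq> \<zero>"
  shows "PIdl x = M"
proof -
  have "ideal M R" using assms(1) by (simp add: minimal_ideal_def)
  then have "x \<in> carrier R" using assms(2) ideal.Icarr by fast
  then have "ideal (PIdl x) R" "x \<in> PIdl x" "PIdl x \<subseteq> M"
    using cgenideal_ideal cgenideal_self cgenideal_minimal[OF \<open>ideal M R\<close> assms(2)] by auto
  then show ?thesis using assms unfolding minimal_ideal_def by blast
qed

text \<open>This is Brauer's lemma for commutative rings. The square of \<open>x\<close> is nonzero
  and so generates \<open>M\<close>; writing \<open>x = s \<otimes> (x \<otimes> x)\<close> makes
  \<open>s \<otimes> x\<close> a nonzero idempotent of \<open>M\<close>.\<close>

lemma idempotent_of_minimal_ideal: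
  assumes M: "minimal_ideal M" and xy: "x \<in> M" "y \<in> M" "x \<otimes> y \<noteq> \<zero>"
  obtains e where "idempotent e" "PIdl e = M"
proof -
  have idl: "ideal M R" using M by (simp add: minimal_ideal_def)
  have c: "x \<in> carrier R" "y \<in> carrier R" using xy idl ideal.Icarr by fast+
  have x0: "x \<noteq> \<zero>" using xy(3) c by auto
  then obtain t where t: "t \<in> carrier R" "y = t \<otimes> x"
    using minimal_ideal_eq_cgenideal[OF M xy(1)] xy(2) by (auto simp: cgenideal_def)
  \<comment> \<open>Since \<open>y\<close> is a multiple of \<open>x\<close>, a vanishing square
    would kill \<open>x \<otimes> y\<close>.\<close>
  have "x \<otimes> x \<noteq> \<zero>"
  proof
    assume "x \<otimes> x = \<zero>"
    then have "x \<otimes> y = \<zero>" using t c by (simp add: m_lcomm)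
    then show False using xy(3) by simp
  qed
  moreover have "x \<otimes> x \<in> M" using idl xy(1) c(1) by (simp add: ideal.I_l_closed)
  ultimately obtain s where s: "s \<in> carrier R" "x = s \<otimes> (x \<otimes> x)"
    using minimal_ideal_eq_cgenideal[OF M, of "x \<otimes> x"] xy(1) by (auto simp: cgenideal_def)
  have "(s \<otimes> x) \<otimes> (s \<otimes> x) = s \<otimes> (s \<otimes> (x \<otimes> x))" using s(1) c(1) by algebra
  then have "idempotent (s \<otimes> x)" using s c by (simp add: idempotent_def)
  moreover have "s \<otimes> x \<noteq> \<zero>"
  proof
    assume "s \<otimes> x = \<zero>"
    then have "s \<otimes> (x \<otimes> x) = \<zero>" using s(1) c(1) by (simp flip: m_assoc)
    then show False using s(2) x0 by simp
  qed
  moreover have "s \<otimes> x \<in> M" using idl xy(1) s(1) by (simp add: ideal.I_l_closed)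
  ultimately show ?thesis using that minimal_ideal_eq_cgenideal[OF M] by blast
qed

text \<open>Being an ideal, the annihilator contains the socle as soon as it contains every minimal
  ideal, so vanishing products need checking only there.\<close>

lemma annihilator_ideal:
  assumes "S \<subseteq> carrier R"
  shows "ideal {x \<in> carrier R. \<forall>y\<in>S. x \<otimes> y = \<zero>} R"
proof (rule idealI)
  have S: "y \<in> carrier R" if "y \<in> S" for y using assms that by auto
  show "subgroup {x \<in> carrier R. \<forall>y\<in>S. x \<otimes> y = \<zero>} (add_monoid R)"
    by (rule add.subgroupI) (auto simp: S l_distr l_minus simp flip: a_inv_def)
  show "x \<otimes> a \<in> {x \<in> carrier R. \<forall>y\<in>S. x \<otimes> y = \<zero>}"
    "a \<otimes> x \<in> {x \<in> carrier R. \<forall>y\<in>S. x \<otimes> y = \<zero>}"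
    if "a \<in> {x \<in> carrier R. \<forall>y\<in>S. x \<otimes> y = \<zero>}" "x \<in> carrier R" for a x
    using that S by (auto simp: m_assoc m_lcomm[of a x])
qed (rule ring_axioms)

definition socle :: "'a set" where
  "socle = Idl (\<Union> {M. minimal_ideal M})"

lemma minimal_ideal_carrier: "minimal_ideal M \<Longrightarrow> M \<subseteq> carrier R"
  unfolding minimal_ideal_def using ideal.Icarr by fast

lemma socle_ideal: "ideal socle R"
  unfolding socle_def using minimal_ideal_carrier by (intro genideal_ideal) auto

lemma minimal_ideal_subset_socle: "minimal_ideal M \<Longrightarrow> M \<subseteq> socle"
  using genideal_self[of "\<Union> {M. minimal_ideal M}"] minimal_ideal_carrier
  unfolding socle_def by blast

lemma socle_subset:
  assumes "ideal I R" "\<And>M. minimal_ideal M \<Longrightarrow> M \<subseteq> I"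
  shows "socle \<subseteq> I"
  unfolding socle_def using assms by (intro genideal_minimal) auto

text \<open>Distinct minimal ideals meet in zero, so their products vanish; a nonzero product inside
  a single one would give an idempotent generator. Annihilators extend this to the socle, one factor
  at a time.\<close>

lemma socle_square_zero:
  assumes no: "\<And>e. idempotent e \<Longrightarrow> \<not> minimal_ideal (PIdl e)"
    and "x \<in> socle" "y \<in> socle"
  shows "x \<otimes> y = \<zero>"
proof -
  have minimal_minimal: "a \<otimes> b = \<zero>"
    if M: "minimal_ideal M" "a \<in> M" and M': "minimal_ideal M'" "b \<in> M'" for a b M M'
  proof (rule ccontr)
    assume ab: "a \<otimes> b \<noteq> \<zero>"
    have idl: "ideal M R" "ideal M' R" using M M' by (auto simp: minimal_ideal_def)
    have "a \<in> carrier R" "b \<in> carrier R" using M M' minimal_ideal_carrier by auto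
    then have "a \<otimes> b \<in> M" "a \<otimes> b \<in> M'"
      using M M' idl by (auto simp: ideal.I_l_closed ideal.I_r_closed)
    \<comment> \<open>The nonzero product lies in both ideals and generates each of them.\<close>
    then have "M = M'"
      using minimal_ideal_eq_cgenideal M M' ab by metis
    then show False
      using idempotent_of_minimal_ideal[OF M(1) M(2) _ ab] M' no M(1) by blast
  qed
  have soc: "socle \<subseteq> carrier R" using socle_ideal ideal.Icarr by fast
  have socle_minimal: "a \<otimes> b = \<zero>" if "a \<in> socle" "minimal_ideal M" "b \<in> M" for a b M
  proof -
    have "socle \<subseteq> {x \<in> carrier R. \<forall>y\<in>M. x \<otimes> y = \<zero>}"
      using minimal_minimal that minimal_ideal_carrier
      by (intro socle_subset annihilator_ideal) fast+
    then show ?thesis using that by blast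
  qed
  have "socle \<subseteq> {x \<in> carrier R. \<forall>y\<in>socle. x \<otimes> y = \<zero>}"
  proof (rule socle_subset[OF annihilator_ideal[OF soc]], intro subsetI CollectI conjI ballI)
    fix M a b assume M: "minimal_ideal M" "a \<in> M"
    then show a: "a \<in> carrier R" using minimal_ideal_carrier by blast
    assume b: "b \<in> socle"
    then show "a \<otimes> b = \<zero>"
      using socle_minimal[OF b M] m_comm[of a b] a soc by auto
  qed
  then show ?thesis using assms by blast
qed

text \<open>Regularity says that multiplication by \<open>r\<close> is injective on
  \<open>J\<close>. As \<open>J\<close> is stable under it, the iterates are injective too.\<close>

lemma regular_pow_mult:
  assumes J: "ideal J R" and r: "module_regular R (ideal_module R J) r"
  shows "x \<in> J \<Longrightarrow> r [^] (n::nat) \<otimes> x = \<zero> \<Longrightarrow> x = \<zero>"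
proof (induction n arbitrary: x)
  case 0
  then show ?case using J ideal.Icarr[OF J] by simp
next
  case (Suc n)
  have c: "r \<in> carrier R" "x \<in> carrier R"
    using r Suc.prems J ideal.Icarr by (auto simp: module_regular_def)
  have rx: "r \<otimes> x \<in> J" using J Suc.prems(1) c by (simp add: ideal.I_l_closed)
  have "r \<otimes> x = \<zero>"
    using Suc.IH[OF rx] Suc.prems(2) c by (simp add: m_assoc)
  then show ?case
    using r Suc.prems(1) c
    by (auto simp: module_regular_def module_zero_divisors_def ideal_module_def)
qed

end

section \<open>Regular graphs of Artinian rings\<close>

context artinian_cring
begin

section \<open>Consequences of the descending chain condition\<close>

text \<open>The chain condition makes strict inclusion well-founded on every family of
  ideals.\<close>

lemma minimal_element_exists:
  assumes "\<And>I. I \<in> \<I> \<Longrightarrow> ideal I R" and "I0 \<in> \<I>"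
  obtains M where "M \<in> \<I>" "\<And>J. J \<in> \<I> \<Longrightarrow> J \<subseteq> M \<Longrightarrow> J = M"
proof -
  let ?r = "{(I, J). I \<in> \<I> \<and> J \<in> \<I> \<and> I \<subset> J}"
  have "wf ?r"
    unfolding wf_iff_no_infinite_down_chain
  proof
    assume "\<exists>C. \<forall>i. (C (Suc i), C i) \<in> ?r"
    then obtain C where C: "\<forall>i. (C (Suc i), C i) \<in> ?r" ..
    have mem: "C i \<in> \<I>" and less: "C (Suc i) \<subset> C i" for i
      using C[rule_format, of i] by simp_all
    have "\<exists>N. \<forall>n\<ge>N. C n = C N"
      by (rule descending_chain_condition) (use mem less assms(1) in \<open>blast+\<close>)
    then obtain N where "\<forall>n\<ge>N. C n = C N" ..
    then have "C (Suc N) = C N" by (meson le_SucI order_refl)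
    then show False using less[of N] by simp
  qed
  then obtain M where M: "M \<in> \<I>" "\<And>J. (J, M) \<in> ?r \<Longrightarrow> J \<notin> \<I>"
    using assms(2) by (rule wfE_min) blast
  have "J = M" if "J \<in> \<I>" "J \<subseteq> M" for J
    using M(1) M(2)[of J] that by auto
  then show ?thesis using that M(1) by blast
qed

lemma minimal_ideal_exists:
  assumes "ideal I R" "I \<noteq> {\<zero>}"
  obtains M where "minimal_ideal M" "M \<subseteq> I"
proof -
  obtain M where M: "M \<in> {J. ideal J R \<and> J \<noteq> {\<zero>} \<and> J \<subseteq> I}"
      "\<And>J. J \<in> {J. ideal J R \<and> J \<noteq> {\<zero>} \<and> J \<subseteq> I} \<Longrightarrow> J \<subseteq> M \<Longrightarrow> J = M"
    by (rule minimal_element_exists[of "{J. ideal J R \<and> J \<noteq> {\<zero>} \<and> J \<subseteq> I}" I])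
      (use assms in auto)
  have "minimal_ideal M"
    unfolding minimal_ideal_def using M by auto
  then show ?thesis using that M(1) by blast
qed

text \<open>The ideals of the powers of \<open>r\<close> become stationary, so a high power
  \<open>p\<close> generates the same ideal as its square. From
  \<open>p = s \<otimes> (p \<otimes> p)\<close> the element \<open>s \<otimes> p\<close> is an
  idempotent that fixes \<open>p\<close>.\<close>

lemma fitting_idempotent:
  assumes r: "r \<in> carrier R"
  obtains e n where "idempotent e" "e \<in> PIdl r" "e \<otimes> r [^] (n::nat) = r [^] n"
proof -
  have "\<exists>N. \<forall>n::nat\<ge>N. PIdl (r [^] n) = PIdl (r [^] N)"
  proof (rule descending_chain_condition[of "\<lambda>n. PIdl (r [^] n)"])
    fix n :: nat
    show "ideal (PIdl (r [^] n)) R" using r by (simp add: cgenideal_ideal)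
    have "r [^] Suc n \<in> PIdl (r [^] n)"
      using r by (simp add: cgenideal_mult)
    then show "PIdl (r [^] Suc n) \<subseteq> PIdl (r [^] n)"
      using r by (intro cgenideal_minimal cgenideal_ideal) auto
  qed
  then obtain N :: nat where N: "\<And>n. n \<ge> N \<Longrightarrow> PIdl (r [^] n) = PIdl (r [^] N)" by blast
  \<comment> \<open>The exponent is \<open>Suc N\<close> rather than \<open>N\<close> so that
    \<open>p\<close> is a multiple of \<open>r\<close> even for \<open>N = 0\<close>; this puts the
    idempotent into \<open>PIdl r\<close>.\<close>
  define p where "p = r [^] Suc N"
  have p: "p \<in> carrier R" using r by (simp add: p_def)
  have "PIdl p = PIdl (r [^] (Suc N + Suc N))"
    unfolding p_def using N[of "Suc N"] N[of "Suc N + Suc N"] by simp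
  then have "PIdl p = PIdl (p \<otimes> p)"
    using r unfolding p_def by (simp only: nat_pow_mult)
  then obtain s where s: "s \<in> carrier R" "p = s \<otimes> (p \<otimes> p)"
    using cgenideal_self[OF p] by (auto simp: cgenideal_def)
  have "(s \<otimes> p) \<otimes> (s \<otimes> p) = s \<otimes> (s \<otimes> (p \<otimes> p))" using s(1) p by algebra
  then have "idempotent (s \<otimes> p)" using s p by (simp add: idempotent_def)
  moreover have "s \<otimes> p = (s \<otimes> r [^] N) \<otimes> r"
    using s(1) r by (simp add: p_def m_assoc)
  then have "s \<otimes> p \<in> PIdl r" using s(1) r by (simp add: cgenideal_mult)
  moreover have "(s \<otimes> p) \<otimes> p = p" using s p by (simp add: m_assoc)
  ultimately show ?thesis using that[of "s \<otimes> p" "Suc N"] unfolding p_def by blast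
qed

section \<open>Adjacency in terms of idempotents\<close>

text \<open>The Fitting idempotent \<open>e\<close> of a regular element \<open>r\<close> satisfies
  \<open>e \<otimes> r [^] n = r [^] n\<close>, so \<open>r [^] n\<close> kills
  \<open>(\<one> \<ominus> e) \<otimes> x\<close> for \<open>x\<close> in \<open>J\<close>;
  regularity makes this element zero, whence \<open>e \<otimes> x = x\<close>. Conversely, an
  idempotent acting as the identity on \<open>J\<close> is regular on it.\<close>

lemma contains_regular_iff:
  assumes I: "ideal I R" and J: "ideal J R"
  shows "contains_regular R I J \<longleftrightarrow> (\<exists>e\<in>I. idempotent e \<and> J \<subseteq> PIdl e)"
proof
  assume "contains_regular R I J"
  then obtain r where r: "r \<in> I" "module_regular R (ideal_module R J) r"
    by (auto simp: contains_regular_def)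
  have rc: "r \<in> carrier R" using I r(1) ideal.Icarr by fast
  obtain e and n :: nat where e: "idempotent e" "e \<in> PIdl r" "e \<otimes> r [^] n = r [^] n"
    using fitting_idempotent[OF rc] by blast
  have ec: "e \<in> carrier R" by (rule idempotent_closed[OF e(1)])
  have "e \<otimes> x = x" if "x \<in> J" for x
  proof -
    have x: "x \<in> carrier R" using J that ideal.Icarr by fast
    have "(\<one> \<ominus> e) \<otimes> x \<in> J" using J that ec by (simp add: ideal.I_l_closed)
    moreover have "r [^] n \<otimes> ((\<one> \<ominus> e) \<otimes> x) = (r [^] n \<ominus> e \<otimes> r [^] n) \<otimes> x"
      using nat_pow_closed[OF rc, of n] ec x by algebra
    then have "r [^] n \<otimes> ((\<one> \<ominus> e) \<otimes> x) = \<zero>"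
      using x rc unfolding e(3) by (simp add: a_minus_def r_neg)
    ultimately have "(\<one> \<ominus> e) \<otimes> x = \<zero>" by (rule regular_pow_mult[OF J r(2)])
    then show ?thesis
      using mem_compl_ideal[OF idempotent_compl[OF e(1)], of x] x
      by (simp add: compl_compl ec mem_idempotent_ideal e(1))
  qed
  then have "J \<subseteq> PIdl e"
    using J ideal.Icarr by (fastforce simp: mem_idempotent_ideal e(1))
  moreover have "e \<in> I" using cgenideal_minimal[OF I r(1)] e(2) by blast
  ultimately show "\<exists>e\<in>I. idempotent e \<and> J \<subseteq> PIdl e" using e(1) by blast
next
  assume "\<exists>e\<in>I. idempotent e \<and> J \<subseteq> PIdl e"
  then obtain e where e: "e \<in> I" "idempotent e" "\<And>x. x \<in> J \<Longrightarrow> e \<otimes> x = x"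
    using mem_idempotent_ideal by blast
  then have "module_regular R (ideal_module R J) e"
    by (auto simp: module_regular_def module_zero_divisors_def ideal_module_def idempotent_closed)
  then show "contains_regular R I J" using e(1) by (auto simp: contains_regular_def)
qed

abbreviation regular_arcs :: "('a set \<times> 'a set) set" where
  "regular_arcs \<equiv> parcs (regular_graph_of_ideals R)"

lemma nontrivial_idealD:
  assumes "I \<in> nontrivial_ideals R"
  shows "ideal I R" "I \<noteq> {\<zero>}" "I \<noteq> carrier R" "\<zero> \<in> I" "\<one> \<notin> I" "I \<subseteq> carrier R"
  using assms ideal.one_imp_carrier additive_subgroup.zero_closed[OF ideal.axioms(1)] ideal.Icarr
  by (fastforce simp: nontrivial_ideals_def)+

lemma regular_arcs_sym: "(I, J) \<in> regular_arcs \<Longrightarrow> (J, I) \<in> regular_arcs"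
  by (auto simp: regular_graph_of_ideals_def)

text \<open>The case names tell whether the arc leads to a smaller or a larger ideal; an idempotent
  ideal always lies between its two ends.\<close>

lemma regular_arcsE:
  assumes "(I, J) \<in> regular_arcs"
  obtains (down) e where "idempotent e" "e \<in> I" "J \<subseteq> PIdl e" "PIdl e \<subseteq> I"
  | (up) e where "idempotent e" "e \<in> J" "I \<subseteq> PIdl e" "PIdl e \<subseteq> J"
proof -
  have "ideal I R" "ideal J R" and "contains_regular R I J \<or> contains_regular R J I"
    using assms by (auto simp: regular_graph_of_ideals_def nontrivial_ideals_def)
  then show thesis
    using that contains_regular_iff cgenideal_minimal by meson
qed

text \<open>The reflexive closure absorbs the case that both vertices equal \<open>PIdl e\<close>,
  so paths can be assembled without distinctness arguments.\<close>

lemma regular_arcs_reflI: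
  assumes "I \<in> nontrivial_ideals R" "J \<in> nontrivial_ideals R"
    and "idempotent e" "e \<in> I" "J \<subseteq> PIdl e"
  shows "(I, J) \<in> regular_arcs\<^sup>=" "(J, I) \<in> regular_arcs\<^sup>="
proof -
  have "contains_regular R I J"
    using assms contains_regular_iff by (auto simp: nontrivial_ideals_def)
  then show "(I, J) \<in> regular_arcs\<^sup>=" "(J, I) \<in> regular_arcs\<^sup>="
    using assms by (auto simp: regular_graph_of_ideals_def)
qed

section \<open>Lower bound: a vertex at distance at least three\<close>

text \<open>The chain condition supplies minimal ideals only, so a largest idempotent is found by
  minimizing the ideal of its complement.\<close>

lemma maximum_idempotent:
  assumes I: "ideal I R"
  obtains e where "idempotent e" "e \<in> I" "\<And>g. idempotent g \<Longrightarrow> g \<in> I \<Longrightarrow> g \<in> PIdl e"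
proof -
  define \<I> where "\<I> = {PIdl (\<one> \<ominus> e) | e. idempotent e \<and> e \<in> I}"
  have "\<zero> \<in> I" using I by (simp add: additive_subgroup.zero_closed ideal.axioms(1))
  then have "PIdl (\<one> \<ominus> \<zero>) \<in> \<I>" unfolding \<I>_def using idempotent_zero by blast
  then obtain M where M: "M \<in> \<I>" "\<And>J. J \<in> \<I> \<Longrightarrow> J \<subseteq> M \<Longrightarrow> J = M"
    by (rule minimal_element_exists[rotated])
      (auto simp: \<I>_def intro!: idempotent_ideal idempotent_compl)
  then obtain e where e: "idempotent e" "e \<in> I" "M = PIdl (\<one> \<ominus> e)" by (auto simp: \<I>_def)
  have "g \<in> PIdl e" if g: "idempotent g" "g \<in> I" for g
  proof -
    have c: "e \<in> carrier R" "g \<in> carrier R" using e g idempotent_closed by auto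
    \<comment> \<open>This is the join of \<open>e\<close> and \<open>g\<close> among the
      idempotents: its complement is the product of their complements. By minimality it cannot
      enlarge \<open>e\<close>.\<close>
    define h where "h = e \<oplus> (\<one> \<ominus> e) \<otimes> g"
    have h: "h \<in> carrier R" using c by (simp add: h_def)
    have hc: "\<one> \<ominus> h = (\<one> \<ominus> e) \<otimes> (\<one> \<ominus> g)" unfolding h_def using c by algebra
    have idem: "idempotent (\<one> \<ominus> h)" unfolding hc using e g by (simp add: idempotent_mult idempotent_compl)
    then have "idempotent h" using idempotent_compl[OF idem] compl_compl[OF h] by simp
    moreover have "h \<in> I"
      unfolding h_def using I e g c
      by (simp add: additive_subgroup.a_closed ideal.axioms(1) ideal.I_l_closed)
    ultimately have "PIdl (\<one> \<ominus> h) \<in> \<I>" unfolding \<I>_def by blast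
    moreover have "\<one> \<ominus> h \<in> PIdl (\<one> \<ominus> e)"
      unfolding hc using c by (simp add: cgenideal_mult)
    then have "PIdl (\<one> \<ominus> h) \<subseteq> PIdl (\<one> \<ominus> e)"
      using e(1) by (intro cgenideal_minimal idempotent_ideal idempotent_compl)
    ultimately have "PIdl (\<one> \<ominus> h) = PIdl (\<one> \<ominus> e)" using M(2) e(3) by blast
    then have "\<one> \<ominus> e \<in> PIdl (\<one> \<ominus> h)"
      using idempotent_mem_ideal[OF idempotent_compl[OF e(1)]] by simp
    then obtain y where y: "y \<in> carrier R" "\<one> \<ominus> e = y \<otimes> ((\<one> \<ominus> e) \<otimes> (\<one> \<ominus> g))"
      by (auto simp: cgenideal_def hc)
    \<comment> \<open>The factor \<open>\<one> \<ominus> g\<close> is annihilated by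
      \<open>g\<close>.\<close>
    have "(\<one> \<ominus> e) \<otimes> g = (y \<otimes> ((\<one> \<ominus> e) \<otimes> (\<one> \<ominus> g))) \<otimes> g" using y(2) by simp
    also have "\<dots> = y \<otimes> (\<one> \<ominus> e) \<otimes> (g \<ominus> g \<otimes> g)" using c y(1) by algebra
    also have "g \<ominus> g \<otimes> g = \<zero>" using g(1) by (simp add: idempotent_def a_minus_def r_neg)
    finally have "(\<one> \<ominus> e) \<otimes> g = \<zero>" using y c by simp
    then have "g \<in> PIdl (\<one> \<ominus> (\<one> \<ominus> e))"
      using mem_compl_ideal[OF idempotent_compl[OF e(1)]] c by simp
    then show ?thesis using compl_compl c by simp
  qed
  then show ?thesis using that e by blast
qed

text \<open>The exclusions rule out walks from \<open>I\<close> to \<open>J\<close> with zero, one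
  and two arcs. The neighbour \<open>K0\<close> guarantees in the second case that the largest
  idempotent of \<open>I\<close> is nonzero.\<close>

lemma distant_vertex_exists:
  assumes I: "I \<in> nontrivial_ideals R" and "(I, K0) \<in> regular_arcs"
  obtains J where "J \<in> nontrivial_ideals R" "J \<noteq> I" "(I, J) \<notin> regular_arcs"
    "\<And>K. (I, K) \<in> regular_arcs \<Longrightarrow> (K, J) \<notin> regular_arcs"
proof (cases "\<exists>f. idempotent f \<and> f \<noteq> \<one> \<and> I \<subseteq> PIdl f")
  case True
  define \<I> where "\<I> = {PIdl f | f. idempotent f \<and> f \<noteq> \<one> \<and> I \<subseteq> PIdl f}"
  from True obtain f0 where "PIdl f0 \<in> \<I>" by (auto simp: \<I>_def)
  then obtain M where M: "M \<in> \<I>" "\<And>J. J \<in> \<I> \<Longrightarrow> J \<subseteq> M \<Longrightarrow> J = M"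
    by (rule minimal_element_exists[rotated]) (auto simp: \<I>_def intro!: idempotent_ideal)
  then obtain f where f: "idempotent f" "f \<noteq> \<one>" "I \<subseteq> PIdl f" "M = PIdl f"
    by (auto simp: \<I>_def)
  have fc: "f \<in> carrier R" by (rule idempotent_closed[OF f(1)])
  define J where "J = PIdl (\<one> \<ominus> f)"
  have dis: "x = \<zero>" if "x \<in> PIdl f" "x \<in> J" for x
    using idempotent_ideal_disjoint[OF f(1)] that by (simp add: J_def)
  have f0: "f \<noteq> \<zero>"
  proof
    assume "f = \<zero>"
    then have "I \<subseteq> {\<zero>}"
      using f(3) by (simp add: cgenideal_zero)
    then show False using nontrivial_idealD[OF I] by blast
  qed
  have J: "J \<in> nontrivial_ideals R"
    unfolding J_def
    using f f0 fc by (intro idempotent_ideal_nontrivial idempotent_compl)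
      (simp_all add: compl_eq_zero_iff compl_eq_one_iff)
  have cJ: "\<one> \<ominus> f \<in> J" unfolding J_def by (intro idempotent_mem_ideal idempotent_compl f)
  have cI: "\<one> \<ominus> f \<notin> I" using dis[OF _ cJ] f(2,3) fc compl_eq_zero_iff by auto
  have IJ: "\<not> I \<subseteq> J" using dis f(3) nontrivial_idealD[OF I] by blast
  have noarc: "(I, J) \<notin> regular_arcs"
    by (auto elim!: regular_arcsE) (use IJ cI cJ in blast)+
  show thesis
  proof (rule that[OF J _ noarc])
    show "J \<noteq> I" using IJ by blast
    fix K assume IK: "(I, K) \<in> regular_arcs"
    show "(K, J) \<notin> regular_arcs"
    proof
      assume KJ: "(K, J) \<in> regular_arcs"
      have K: "K \<in> nontrivial_ideals R" using IK by (auto simp: regular_graph_of_ideals_def)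
      show False
        using IK
      proof (cases rule: regular_arcsE)
        \<comment> \<open>Here \<open>K\<close> lies in \<open>I\<close>, hence in
          \<open>PIdl f\<close>. If \<open>J\<close> were inside \<open>K\<close>, then
          \<open>\<one> \<ominus> f\<close> would be in \<open>I\<close>; if \<open>K\<close> were
          inside \<open>J\<close>, it would be zero.\<close>
        case (down e)
        from KJ show False
          by (cases rule: regular_arcsE)
            (use down cI cJ dis f(3) nontrivial_idealD[OF K] in blast)+
      next
        case (up e)
        from KJ show False
        proof (cases rule: regular_arcsE)
          \<comment> \<open>The critical case: \<open>K\<close> contains both \<open>I\<close> and
            \<open>J\<close>. Since \<open>PIdl (e \<otimes> f)\<close> still contains
            \<open>I\<close>, minimality forces it to be \<open>PIdl f\<close>. Thus
            \<open>K\<close> contains \<open>f\<close> as well as its complement.\<close>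
          case (down g)
          have ec: "e \<in> carrier R" by (rule idempotent_closed[OF up(1)])
          have ef: "idempotent (e \<otimes> f)" by (rule idempotent_mult[OF up(1) f(1)])
          have mem: "e \<otimes> f \<in> PIdl f" "e \<otimes> f \<in> PIdl e"
            using ec fc by (simp_all add: cgenideal_mult)
          then have sub: "PIdl (e \<otimes> f) \<subseteq> PIdl f" "PIdl (e \<otimes> f) \<subseteq> PIdl e"
            using up(1) f(1) by (auto intro!: cgenideal_minimal idempotent_ideal del: subsetI)
          have "e \<otimes> f \<noteq> \<one>"
            using mem(1) f(2) fc by (auto simp: mem_idempotent_ideal f(1))
          moreover have "I \<subseteq> PIdl (e \<otimes> f)"
            using up(3) f(3) ec fc
            by (auto simp: mem_idempotent_ideal ef up(1) f(1) m_assoc subset_iff)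
          ultimately have "PIdl (e \<otimes> f) \<in> \<I>" using ef by (auto simp: \<I>_def)
          then have "PIdl (e \<otimes> f) = PIdl f" using M(2) f(4) sub(1) by blast
          then have "f \<in> K" using idempotent_mem_ideal[OF f(1)] sub(2) up(4) by blast
          moreover have "\<one> \<ominus> f \<in> K" using cJ down by blast
          ultimately show False
            using idempotent_and_compl_mem nontrivial_idealD[OF K] by blast
        next
          case (up g)
          then show False using \<open>I \<subseteq> PIdl e\<close> \<open>PIdl e \<subseteq> K\<close> IJ by blast
        qed
      qed
    qed
  qed
next
  case False
  then have one: "f = \<one>" if "idempotent f" "I \<subseteq> PIdl f" for f
    using that by blast
  obtain e where e: "idempotent e" "e \<in> I" "\<And>g. idempotent g \<Longrightarrow> g \<in> I \<Longrightarrow> g \<in> PIdl e"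
    using maximum_idempotent nontrivial_idealD(1)[OF I] by blast
  have ec: "e \<in> carrier R" by (rule idempotent_closed[OF e(1)])
  have e1: "e \<noteq> \<one>" using e(2) nontrivial_idealD[OF I] by blast
  \<comment> \<open>A neighbour above \<open>I\<close> would contain an idempotent \<open>g\<close>
    with \<open>I \<subseteq> PIdl g\<close>, which must be \<open>\<one>\<close>. Hence all
    neighbours lie below \<open>I\<close>, under an idempotent of \<open>I\<close>.\<close>
  have neighbour: "K \<subseteq> PIdl e" if "(I, K) \<in> regular_arcs" for K
    using that
  proof (cases rule: regular_arcsE)
    case (down g)
    have "PIdl g \<subseteq> PIdl e"
      using e(3)[OF down(1,2)] e(1) by (intro cgenideal_minimal idempotent_ideal)
    then show ?thesis using down(3) by blast
  next
    case (up g)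
    then have "\<one> \<in> K" using one by blast
    moreover have "K \<in> nontrivial_ideals R" using that by (auto simp: regular_graph_of_ideals_def)
    ultimately show ?thesis using nontrivial_idealD by blast
  qed
  have e0: "e \<noteq> \<zero>"
  proof
    assume "e = \<zero>"
    then have "K0 \<subseteq> {\<zero>}"
      using neighbour[OF assms(2)] by (simp add: cgenideal_zero)
    moreover have "K0 \<in> nontrivial_ideals R"
      using assms(2) by (auto simp: regular_graph_of_ideals_def)
    ultimately show False using nontrivial_idealD[of K0] by blast
  qed
  define J where "J = PIdl (\<one> \<ominus> e)"
  have dis: "x = \<zero>" if "x \<in> PIdl e" "x \<in> J" for x
    using idempotent_ideal_disjoint[OF e(1)] that by (simp add: J_def)
  have J: "J \<in> nontrivial_ideals R"
    unfolding J_def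
    using e e0 e1 ec by (intro idempotent_ideal_nontrivial idempotent_compl)
      (simp_all add: compl_eq_zero_iff compl_eq_one_iff)
  have cJ: "\<one> \<ominus> e \<in> J" unfolding J_def by (intro idempotent_mem_ideal idempotent_compl e)
  have ce: "\<one> \<ominus> e \<notin> PIdl e" using dis[OF _ cJ] e1 ec compl_eq_zero_iff by auto
  show thesis
  proof (rule that[OF J])
    show "J \<noteq> I" using dis[of e] e e0 idempotent_mem_ideal by blast
    show "(I, J) \<notin> regular_arcs" using neighbour[of J] cJ ce by blast
    fix K assume "(I, K) \<in> regular_arcs"
    then have K: "K \<in> nontrivial_ideals R" "K \<subseteq> PIdl e"
      using neighbour by (auto simp: regular_graph_of_ideals_def)
    show "(K, J) \<notin> regular_arcs"
      by (auto elim!: regular_arcsE) (use K(2) cJ ce dis nontrivial_idealD[OF K(1)] in blast)+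
  qed
qed

section \<open>Upper bound: a vertex that reaches all others in three steps\<close>

lemma center_reaches:
  assumes e: "idempotent e" "minimal_ideal (PIdl e)"
    and g: "idempotent g" "g \<in> PIdl (\<one> \<ominus> e)" "g \<noteq> \<zero>" "g \<noteq> \<one> \<ominus> e"
  shows "PIdl (e \<oplus> g) \<in> nontrivial_ideals R"
    and "J \<in> nontrivial_ideals R \<Longrightarrow> (PIdl (e \<oplus> g), J) \<in> (regular_arcs\<^sup>=) ^^ 3"
proof -
  have c: "e \<in> carrier R" "g \<in> carrier R" using e g idempotent_closed by auto
  have sq: "e \<otimes> e = e" "g \<otimes> g = g" using e g by (auto simp: idempotent_def)
  have eg: "e \<otimes> g = \<zero>" using g(2) mem_compl_ideal[OF e(1)] by simp
  have e0: "e \<noteq> \<zero>" using e(2) by (auto simp: minimal_ideal_def cgenideal_zero)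
  have e1: "e \<noteq> \<one>" using eg g(3) c by auto
  define X where "X = PIdl (e \<oplus> g)"
  \<comment> \<open>Orthogonality of \<open>e\<close> and \<open>g\<close> makes their sum an
    idempotent whose ideal contains both.\<close>
  have ce: "(e \<oplus> g) \<otimes> e = e" and cg: "(e \<oplus> g) \<otimes> g = g"
    using c sq eg m_comm[of g e] by (simp_all add: l_distr)
  have s: "idempotent (e \<oplus> g)"
    using c ce cg by (simp add: idempotent_def r_distr)
  have "e \<oplus> g \<noteq> \<zero>" using ce e0 c by auto
  moreover have "e \<oplus> g \<noteq> \<one>"
  proof
    assume *: "e \<oplus> g = \<one>"
    have "g = (e \<oplus> g) \<ominus> e" using c by algebra
    then show False using * g(4) by simp
  qed
  ultimately show X: "PIdl (e \<oplus> g) \<in> nontrivial_ideals R"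
    using s by (intro idempotent_ideal_nontrivial)
  have eX: "e \<in> X" and gX: "g \<in> X"
    using c ce cg by (simp_all add: X_def mem_idempotent_ideal s)
  show "(PIdl (e \<oplus> g), J) \<in> (regular_arcs\<^sup>=) ^^ 3" if J: "J \<in> nontrivial_ideals R"
  proof (cases "e \<in> J")
    case True
    have E: "PIdl e \<in> nontrivial_ideals R"
      using e e0 e1 by (intro idempotent_ideal_nontrivial)
    have "(X, PIdl e) \<in> regular_arcs\<^sup>="
      using regular_arcs_reflI(1)[OF X[folded X_def] E e(1) eX] by blast
    moreover have "(PIdl e, J) \<in> regular_arcs\<^sup>="
      using regular_arcs_reflI(2)[OF J E e(1) True] by blast
    ultimately show ?thesis
      \<comment> \<open>No wait\<close>
      unfolding X_def[symmetric] numeral_3_eq_3 relpow.simps by blast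
  next
    case False
    have idl: "ideal (PIdl e \<inter> J) R"
      using idempotent_ideal[OF e(1)] nontrivial_idealD(1)[OF J] by (rule i_intersect)
    have "PIdl e \<inter> J \<noteq> PIdl e" using False idempotent_mem_ideal[OF e(1)] by blast
    then have zero: "PIdl e \<inter> J = {\<zero>}" using e(2) idl unfolding minimal_ideal_def by blast
    have "J \<subseteq> PIdl (\<one> \<ominus> e)"
    proof
      fix x assume x: "x \<in> J"
      then have xc: "x \<in> carrier R" using nontrivial_idealD[OF J] by blast
      have "e \<otimes> x \<in> PIdl e" using c xc by (simp add: cgenideal_mult)
      moreover have "e \<otimes> x \<in> J"
        using nontrivial_idealD(1)[OF J] x c(1) by (simp add: ideal.I_l_closed)
      ultimately have "e \<otimes> x = \<zero>" using zero by blast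
      then show "x \<in> PIdl (\<one> \<ominus> e)" using xc mem_compl_ideal[OF e(1)] by simp
    qed
    moreover have K: "PIdl (\<one> \<ominus> e) \<in> nontrivial_ideals R"
      using e(1) e0 e1 c by (intro idempotent_ideal_nontrivial idempotent_compl)
        (simp_all add: compl_eq_zero_iff compl_eq_one_iff)
    moreover have G: "PIdl g \<in> nontrivial_ideals R"
      using g(1,3) e0 eg c by (intro idempotent_ideal_nontrivial) auto
    ultimately have "(PIdl (\<one> \<ominus> e), J) \<in> regular_arcs\<^sup>="
      using regular_arcs_reflI(1)[OF K J idempotent_compl[OF e(1)]]
        idempotent_mem_ideal[OF idempotent_compl[OF e(1)]] by blast
    moreover have "(PIdl g, PIdl (\<one> \<ominus> e)) \<in> regular_arcs\<^sup>="
      using regular_arcs_reflI(2)[OF K G g(1,2)] by blast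
    moreover have "(X, PIdl g) \<in> regular_arcs\<^sup>="
      using regular_arcs_reflI(1)[OF X[folded X_def] G g(1) gX] by blast
    ultimately show ?thesis
      unfolding X_def[symmetric] numeral_3_eq_3 relpow.simps by blast
  qed
qed

end

locale connected_regular_graph = artinian_cring +
  assumes graph_connected:
      "Digraph_Component.connected (with_proj (regular_graph_of_ideals R))"
    and two_vertices: "\<exists>I\<in>nontrivial_ideals R. \<exists>J\<in>nontrivial_ideals R. I \<noteq> J"
begin

lemma regular_graph_wf: "pair_wf_digraph (regular_graph_of_ideals R)"
  by unfold_locales (auto simp: regular_graph_of_ideals_def)

lemma closed_set_contains_vertices:
  assumes "\<And>I J. I \<in> A \<Longrightarrow> (I, J) \<in> regular_arcs \<Longrightarrow> J \<in> A"
    and "I \<in> A" "I \<in> nontrivial_ideals R" "J \<in> nontrivial_ideals R"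
  shows "J \<in> A"
proof (rule connected_closed_set[OF graph_connected])
  show "K \<in> A" if "I \<in> A" "(I, K) \<in> regular_arcs \<or> (K, I) \<in> regular_arcs" for I K
    using assms(1) regular_arcs_sym that by blast
qed (use assms in \<open>auto simp: regular_graph_of_ideals_def\<close>)

lemma neighbour_exists:
  assumes "I \<in> nontrivial_ideals R"
  obtains K where "(I, K) \<in> regular_arcs"
proof (rule ccontr)
  assume "\<not> thesis"
  then have "(I, K) \<notin> regular_arcs" for K using that by blast
  then have "J \<in> {I}" if "J \<in> nontrivial_ideals R" for J
    using assms that by (intro closed_set_contains_vertices[of "{I}" I J]) auto
  then show False using two_vertices by blast
qed

lemma field_component_exists:
  obtains e where "idempotent e" "minimal_ideal (PIdl e)"
proof (rule ccontr)
  assume "\<not> thesis"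
  then have no: "\<And>e. idempotent e \<Longrightarrow> \<not> minimal_ideal (PIdl e)" using that by blast
  have sq: "x \<otimes> y = \<zero>" if "x \<in> socle" "y \<in> socle" for x y
    using socle_square_zero no that by blast
  have no_idem: "e = \<zero>" if "idempotent e" "e \<in> socle" for e
    using sq[OF that(2,2)] that(1) by (simp add: idempotent_def)
  have one_zero: "\<one> \<noteq> \<zero>"
    using two_vertices one_zeroD nontrivial_idealD by blast
  have not_sub: "f = \<one>" if f: "idempotent f" "socle \<subseteq> PIdl f" for f
  proof (rule ccontr)
    assume "f \<noteq> \<one>"
    then have "\<one> \<ominus> f \<noteq> \<zero>" using f(1) by (simp add: compl_eq_zero_iff idempotent_closed)
    then have "PIdl (\<one> \<ominus> f) \<noteq> {\<zero>}"
      using idempotent_mem_ideal[OF idempotent_compl[OF f(1)]] by blast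
    then obtain M where M: "minimal_ideal M" "M \<subseteq> PIdl (\<one> \<ominus> f)"
      using minimal_ideal_exists idempotent_ideal[OF idempotent_compl[OF f(1)]] by blast
    have "M \<subseteq> PIdl f" using minimal_ideal_subset_socle[OF M(1)] f(2) by blast
    then have "M \<subseteq> {\<zero>}" using idempotent_ideal_disjoint[OF f(1)] M(2) by blast
    then show False
      using M(1) additive_subgroup.zero_closed[OF ideal.axioms(1)]
      by (fastforce simp: minimal_ideal_def)
  qed
  have "socle \<noteq> {\<zero>}"
  proof
    assume "socle = {\<zero>}"
    then have "\<zero> = \<one>" by (intro not_sub idempotent_zero) (simp add: cgenideal_zero)
    then show False using one_zero by simp
  qed
  moreover have "socle \<noteq> carrier R" using no_idem[OF idempotent_one] one_zero one_closed by blast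
  ultimately have vertex: "socle \<in> nontrivial_ideals R"
    using socle_ideal by (simp add: nontrivial_ideals_def)
  obtain K where arc: "(socle, K) \<in> regular_arcs" using neighbour_exists[OF vertex] .
  then have K: "K \<in> nontrivial_ideals R" by (auto simp: regular_graph_of_ideals_def)
  from arc show False
  proof (cases rule: regular_arcsE)
    case (down e)
    then have "K \<subseteq> {\<zero>}" using no_idem[OF down(1,2)] by (simp add: cgenideal_zero)
    then show False using nontrivial_idealD[OF K] by blast
  next
    case (up e)
    then show False using not_sub nontrivial_idealD[OF K] by blast
  qed
qed

lemma complement_decomposable:
  assumes e: "idempotent e" "minimal_ideal (PIdl e)"
  obtains g where "idempotent g" "g \<in> PIdl (\<one> \<ominus> e)" "g \<noteq> \<zero>" "g \<noteq> \<one> \<ominus> e"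
proof (rule ccontr)
  note complement = that
  assume "\<not> thesis"
  then have only: "g = \<zero> \<or> g = \<one> \<ominus> e" if "idempotent g" "g \<in> PIdl (\<one> \<ominus> e)" for g
    using complement that by blast
  have ec: "e \<in> carrier R" by (rule idempotent_closed[OF e(1)])
  have e0: "e \<noteq> \<zero>" using e(2) by (auto simp: minimal_ideal_def cgenideal_zero)
  have e1: "e \<noteq> \<one>"
  proof
    assume "e = \<one>"
    then have "PIdl e = carrier R" by (auto simp: mem_idempotent_ideal idempotent_one)
    then show False
      using e(2) two_vertices nontrivial_idealD unfolding minimal_ideal_def by metis
  qed
  have E: "PIdl e \<in> nontrivial_ideals R" and E': "PIdl (\<one> \<ominus> e) \<in> nontrivial_ideals R"
    using e(1) e0 e1 ec by (auto intro!: idempotent_ideal_nontrivial idempotent_compl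
      simp: compl_eq_zero_iff compl_eq_one_iff)
  have "PIdl (\<one> \<ominus> e) \<in> {K. e \<in> K}"
  proof (rule closed_set_contains_vertices[OF _ _ E E'])
    show "PIdl e \<in> {K. e \<in> K}" using idempotent_mem_ideal[OF e(1)] by simp
    fix K L assume eK: "K \<in> {K. e \<in> K}" and arc: "(K, L) \<in> regular_arcs"
    then have K: "K \<in> nontrivial_ideals R" and L: "L \<in> nontrivial_ideals R"
      by (auto simp: regular_graph_of_ideals_def)
    from arc show "L \<in> {K. e \<in> K}"
    proof (cases rule: regular_arcsE)
      case (down g)
      have gc: "g \<in> carrier R" by (rule idempotent_closed[OF down(1)])
      have "(\<one> \<ominus> e) \<otimes> g \<in> PIdl (\<one> \<ominus> e)"
        using ec gc by (simp add: cgenideal_mult)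
      then consider "(\<one> \<ominus> e) \<otimes> g = \<zero>" | "(\<one> \<ominus> e) \<otimes> g = \<one> \<ominus> e"
        using only idempotent_mult[OF idempotent_compl[OF e(1)] down(1)] by blast
      then show ?thesis
      proof cases
        case 1
        then have "g \<in> PIdl e"
          using mem_compl_ideal[OF idempotent_compl[OF e(1)], of g] gc ec by (simp add: compl_compl)
        then have "PIdl g \<subseteq> PIdl e" using e(1) by (intro cgenideal_minimal idempotent_ideal)
        then have "L \<subseteq> PIdl e" using down(3) by blast
        then have "L = PIdl e"
          using e(2) nontrivial_idealD[OF L] unfolding minimal_ideal_def by blast
        then show ?thesis using idempotent_mem_ideal[OF e(1)] by simp
      next
        case 2
        then have "\<one> \<ominus> e \<in> PIdl g" using ec gc cgenideal_mult(1)[of g "\<one> \<ominus> e"] by simp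
        then have "\<one> \<ominus> e \<in> K" using down(4) by blast
        then show ?thesis
          using eK idempotent_and_compl_mem nontrivial_idealD[OF K] by blast
      qed
    next
      case (up g)
      then show ?thesis using eK by blast
    qed
  qed
  then have "e = \<zero>"
    using idempotent_ideal_disjoint[OF e(1) idempotent_mem_ideal[OF e(1)]] by simp
  then show False using e0 by simp
qed

lemma eccentricity_ge_3:
  assumes I: "I \<in> nontrivial_ideals R"
  shows "3 \<le> eccentricity (with_proj (regular_graph_of_ideals R)) I"
proof -
  interpret G: pair_wf_digraph "regular_graph_of_ideals R" by (rule regular_graph_wf)
  obtain K0 where "(I, K0) \<in> regular_arcs" using neighbour_exists[OF I] .
  then obtain J where J: "J \<in> nontrivial_ideals R" "J \<noteq> I" "(I, J) \<notin> regular_arcs"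
      "\<And>K. (I, K) \<in> regular_arcs \<Longrightarrow> (K, J) \<notin> regular_arcs"
    using distant_vertex_exists[OF I] by blast
  have "(I, J) \<notin> regular_arcs ^^ k" if "k < 3" for k
  proof -
    consider "k = 0" | "k = Suc 0" | "k = Suc (Suc 0)" using \<open>k < 3\<close> by linarith
    then show ?thesis using J by cases auto
  qed
  then have "ereal (real 3) \<le> graph_distance (with_proj (regular_graph_of_ideals R)) I J"
    by (rule G.graph_distance_ge)
  also have "\<dots> \<le> eccentricity (with_proj (regular_graph_of_ideals R)) I"
    unfolding eccentricity_def using J by (intro SUP_upper) (simp add: regular_graph_of_ideals_def)
  finally show ?thesis by simp
qed

lemma center_exists:
  obtains X where "X \<in> nontrivial_ideals R"
    "eccentricity (with_proj (regular_graph_of_ideals R)) X \<le> 3"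
proof -
  interpret G: pair_wf_digraph "regular_graph_of_ideals R" by (rule regular_graph_wf)
  obtain e where e: "idempotent e" "minimal_ideal (PIdl e)" using field_component_exists .
  obtain g where g: "idempotent g" "g \<in> PIdl (\<one> \<ominus> e)" "g \<noteq> \<zero>" "g \<noteq> \<one> \<ominus> e"
    using complement_decomposable[OF e] .
  note X = center_reaches[OF e g]
  have "graph_distance (with_proj (regular_graph_of_ideals R)) (PIdl (e \<oplus> g)) J \<le> ereal (real 3)"
    if "J \<in> nontrivial_ideals R" for J
    using X that by (intro G.graph_distance_le) (simp_all add: regular_graph_of_ideals_def)
  then have "eccentricity (with_proj (regular_graph_of_ideals R)) (PIdl (e \<oplus> g)) \<le> 3"
    unfolding eccentricity_def by (intro SUP_least) (simp add: regular_graph_of_ideals_def)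
  then show ?thesis using that X(1) by blast
qed

end

theorem theorem15:
  fixes R :: "('a, 'm) ring_scheme"
  assumes "artinian_cring R"
    and "Digraph_Component.connected (with_proj (regular_graph_of_ideals R))"
    and "\<exists>I \<in> verts (with_proj (regular_graph_of_ideals R)).
         \<exists>J \<in> verts (with_proj (regular_graph_of_ideals R)). I \<noteq> J"
  shows "radius (with_proj (regular_graph_of_ideals R)) = 3"
proof -
  interpret artinian_cring R by (rule assms(1))
  interpret connected_regular_graph R
    using assms(2,3) by unfold_locales (simp_all add: regular_graph_of_ideals_def)
  obtain X where "X \<in> nontrivial_ideals R"
      "eccentricity (with_proj (regular_graph_of_ideals R)) X \<le> 3"
    using center_exists .
  then show ?thesis
    unfolding radius_def
    by (intro antisym INF_lower2[of X] INF_greatest eccentricity_ge_3)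
      (auto simp: regular_graph_of_ideals_def)
qed

end
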